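(* Fix $v\in\mathbb{R}^d$ and let $h(x)=\|x-v\|_2^2$. Let $g_1,\dots,g_s$ be SOS-convex polynomials on $\mathbb{R}^d$ and let $\mathcal{D}=\{x\in\mathbb{R}^d: g_j(x)\le 0,\ j=1,\dots,s\}$. Let $(\mathrm{SDP}_v)$ and $(\mathrm{MP}_v)$ be the semidefinite programs defined in the context, and assume that $\max(\mathrm{SDP}_v)=\min(\mathrm{MP}_v)$. Suppose that $y_v^*=(y^*_{v,\alpha})_{\alpha\in\mathbf{N}^d_\omega}\in\mathbb{R}^{s(d,\omega)}$ is a solution of $(\mathrm{MP}_v)$. Then $$P_{\mathcal{D}}(v)=\big(y^*_{v,e_1},\dots,y^*_{v,e_d}\big),$$ where $e_i\in\mathbf{N}^d_\omega$, $i=1,\dots,d$, is the multi-index whose $i$-th component is one and whose other components are zero.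
   Context: $P_{\mathcal{D}}$ denotes the Euclidean projection onto the closed convex set $\mathcal{D}$. A real polynomial $g$ on $\mathbb{R}^d$ is SOS-convex if its Hessian can be written as $P(x)^\top P(x)$ for some $\nu\times d$ polynomial matrix $P(x)$, $\nu\in\mathbb{N}$. $\mathbb{S}^n$ is the space of real symmetric $n\times n$ matrices, $\mathbb{S}^n_+$ the cone of positive semidefinite ones, and $M\succeq0$ means $M$ is positive semidefinite. Let $\omega$ be the smallest even integer with $\omega\ge\max_{j}\deg g_j$ and $\omega\ge 2$ (so that $h$ and all $g_j$ have degree at most $\omega$). Let $\mathbf{N}^d_\omega=\{\alpha=(\alpha_1,\dots,\alpha_d)\in\mathbb{Z}_{\ge0}^d:\sum_i\alpha_i\le\omega\}$ and $s(d,\omega)=|\mathbf{N}^d_\omega|=\binom{d+\omega}{\omega}$. Write $h(x)=\sum_{\alpha\in\mathbf{N}^d_\omega}h_\alpha x^\alpha$ and $g_j(x)=\sum_{\alpha\in\mathbf{N}^d_\omega}(g_j)_\alpha x^\alpha$. Let $\nu_0=s(d,\omega/2)$, let $y(x)$ be the vector of all monomials in $x$ of degree at most $\omega/2$, and let $B_\alpha\in\mathbb{S}^{\nu_0}$, $\alpha\in\mathbf{N}^d_\omega$, be the matrices determined by $y(x)y(x)^\top=\sum_{\alpha\in\mathbf{N}^d_\omega}B_\alpha x^\alpha$ for all $x$. Put $q_\alpha=1$ if $\alpha=0$ and $q_\alpha=0$ otherwise. $(\mathrm{SDP}_v)$: $$\max_{\lambda\in\mathbb{R}^s_+,\,\gamma\in\mathbb{R},\,Q\in\mathbb{S}^{\nu_0}_+}\Big\{\gamma:\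 h_\alpha+\sum_{j=1}^s\lambda_j(g_j)_\alpha-\gamma q_\alpha=\mathrm{tr}(QB_\alpha),\ \alpha\in\mathbf{N}^d_\omega\Big\}.$$ $(\mathrm{MP}_v)$: $$\min_{y\in\mathbb{R}^{s(d,\omega)}}\Big\{\sum_{\alpha\in\mathbf{N}^d_\omega}h_\alpha y_\alpha:\ \sum_{\alpha\in\mathbf{N}^d_\omega}(g_j)_\alpha y_\alpha\le0,\ j=1,\dots,s,\ \sum_{\alpha\in\mathbf{N}^d_\omega}y_\alpha B_\alpha\succeq0,\ y_0=1\Big\},$$ where $y_0$ is the entry of $y$ indexed by the zero multi-index. *)

theory Defs
  imports "HOL-Analysis.Analysis" "HOL-Library.Poly_Mapping"
begin

text \<open>
  A multi-index is an element of \<^typ>\<open>nat ^ 'd\<close>, and a real polynomial in the variables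
  \<open>x $ i\<close> is the finitely supported map from multi-indices to its coefficients; the
  multiplication on this type is convolution, i.e. the product of polynomials.
\<close>

definition mindex_deg :: "nat ^ 'd \<Rightarrow> nat" where
  "mindex_deg \<alpha> = (\<Sum>i\<in>UNIV. \<alpha> $ i)"

definition mindices :: "nat \<Rightarrow> (nat ^ 'd) set" where
  "mindices w = {\<alpha>. mindex_deg \<alpha> \<le> w}"

lemma finite_mindices: "finite (mindices w :: (nat ^ 'd) set)"
proof (rule finite_subset)
  show "(mindices w :: (nat ^ 'd) set) \<subseteq> vec_lambda ` (UNIV \<rightarrow>\<^sub>E {..w})"
  proof
    fix \<alpha> :: "nat ^ 'd"
    assume "\<alpha> \<in> mindices w"
    moreover have "\<alpha> $ i \<le> (\<Sum>i\<in>UNIV. \<alpha> $ i)" for i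
      by (rule member_le_sum) auto
    ultimately have "\<alpha> $ i \<le> w" for i
      unfolding mindices_def mindex_deg_def mem_Collect_eq using le_trans by blast
    then have "vec_nth \<alpha> \<in> UNIV \<rightarrow>\<^sub>E {..w}"
      by auto
    then show "\<alpha> \<in> vec_lambda ` (UNIV \<rightarrow>\<^sub>E {..w})"
      by (metis image_eqI vec_nth_inverse)
  qed
  show "finite (vec_lambda ` (UNIV \<rightarrow>\<^sub>E {..w}) :: (nat ^ 'd) set)"
    by (intro finite_imageI finite_PiE) auto
qed

definition monom_at :: "nat ^ 'd \<Rightarrow> real ^ 'd \<Rightarrow> real" where
  "monom_at \<alpha> x = (\<Prod>i\<in>UNIV. (x $ i) ^ (\<alpha> $ i))"

definition poly_at :: "(nat ^ 'd \<Rightarrow>\<^sub>0 real) \<Rightarrow> real ^ 'd \<Rightarrow> real" where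
  "poly_at p x = (\<Sum>\<alpha>\<in>Poly_Mapping.keys p. Poly_Mapping.lookup p \<alpha> * monom_at \<alpha> x)"

text \<open>The zero polynomial gets degree 0.\<close>

definition poly_deg :: "(nat ^ 'd \<Rightarrow>\<^sub>0 real) \<Rightarrow> nat" where
  "poly_deg p = Max (insert 0 (mindex_deg ` Poly_Mapping.keys p))"

definition partial_deriv :: "'d \<Rightarrow> (real ^ 'd \<Rightarrow> real) \<Rightarrow> real ^ 'd \<Rightarrow> real" where
  "partial_deriv i f x = frechet_derivative f (at x) (axis i 1)"

definition hessian :: "(real ^ 'd \<Rightarrow> real) \<Rightarrow> real ^ 'd \<Rightarrow> real ^ 'd ^ 'd" where
  "hessian f x = (\<chi> i j. partial_deriv i (partial_deriv j f) x)"

text \<open>\<open>P k i\<close> with \<open>k < \<nu>\<close> is the \<open>(k, i)\<close> entry of the \<open>\<nu> \<times> d\<close> polynomial matrix.\<close>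

definition sos_convex :: "(nat ^ 'd \<Rightarrow>\<^sub>0 real) \<Rightarrow> bool" where
  "sos_convex p \<longleftrightarrow> (\<exists>(\<nu>::nat) (P :: nat \<Rightarrow> 'd \<Rightarrow> (nat ^ 'd \<Rightarrow>\<^sub>0 real)).
     \<forall>x. hessian (poly_at p) x = (\<chi> i j. \<Sum>k<\<nu>. poly_at (P k i) x * poly_at (P k j) x))"

definition sdp_order :: "('s::finite \<Rightarrow> (nat ^ 'd \<Rightarrow>\<^sub>0 real)) \<Rightarrow> nat" where
  "sdp_order g = (LEAST w. even w \<and> (MAX j. poly_deg (g j)) \<le> w \<and> 2 \<le> w)"

text \<open>
  A matrix whose rows and columns are labelled by the finite set \<open>I\<close> is a function of two
  arguments, only the values on \<open>I \<times> I\<close> being relevant. Taking the multi-indices of degree at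
  most \<open>\<omega> / 2\<close> themselves as labels avoids choosing an enumeration of the monomials.
\<close>

definition psd_on :: "'a set \<Rightarrow> ('a \<Rightarrow> 'a \<Rightarrow> real) \<Rightarrow> bool" where
  "psd_on I M \<longleftrightarrow> (\<forall>\<beta>\<in>I. \<forall>\<gamma>\<in>I. M \<beta> \<gamma> = M \<gamma> \<beta>) \<and>
     (\<forall>u. 0 \<le> (\<Sum>\<beta>\<in>I. \<Sum>\<gamma>\<in>I. u \<beta> * M \<beta> \<gamma> * u \<gamma>))"

definition trace_prod_on :: "'a set \<Rightarrow> ('a \<Rightarrow> 'a \<Rightarrow> real) \<Rightarrow> ('a \<Rightarrow> 'a \<Rightarrow> real) \<Rightarrow> real" where
  "trace_prod_on I A B = (\<Sum>\<beta>\<in>I. \<Sum>\<gamma>\<in>I. A \<beta> \<gamma> * B \<gamma> \<beta>)"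

text \<open>
  The \<open>(\<beta>, \<gamma>)\<close> entry of \<open>B\<^sub>\<alpha>\<close> is the coefficient of \<open>x\<^sup>\<alpha>\<close> in the \<open>(\<beta>, \<gamma>)\<close> entry
  \<open>x\<^sup>\<beta> x\<^sup>\<gamma>\<close> of the polynomial matrix \<open>y(x) y(x)\<^sup>T\<close>.
\<close>

definition Bmat :: "nat ^ 'd \<Rightarrow> nat ^ 'd \<Rightarrow> nat ^ 'd \<Rightarrow> real" where
  "Bmat \<alpha> \<beta> \<gamma> =
     Poly_Mapping.lookup (Poly_Mapping.single \<beta> 1 * Poly_Mapping.single \<gamma> 1) \<alpha>"

lemma Bmat_expansion:
  fixes x :: "real ^ 'd"
  assumes "even w" "\<beta> \<in> mindices (w div 2)" "\<gamma> \<in> mindices (w div 2)"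
  shows "monom_at \<beta> x * monom_at \<gamma> x = (\<Sum>\<alpha>\<in>mindices w. Bmat \<alpha> \<beta> \<gamma> * monom_at \<alpha> x)"
proof -
  have "\<beta> + \<gamma> \<in> mindices w"
    using assms by (auto simp: mindices_def mindex_deg_def sum.distrib elim!: evenE)
  moreover have "Bmat \<alpha> \<beta> \<gamma> = (if \<alpha> = \<beta> + \<gamma> then 1 else 0)" for \<alpha>
    by (auto simp: Bmat_def Poly_Mapping.mult_single Poly_Mapping.lookup_single when_def)
  ultimately have "(\<Sum>\<alpha>\<in>mindices w. Bmat \<alpha> \<beta> \<gamma> * monom_at \<alpha> x) = monom_at (\<beta> + \<gamma>) x"
    by (simp add: if_distrib[of "\<lambda>c. c * _"] sum.delta finite_mindices cong: if_cong)
  then show ?thesis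
    by (simp add: monom_at_def power_add prod.distrib)
qed

definition sdp_feasible ::
  "(nat ^ 'd \<Rightarrow>\<^sub>0 real) \<Rightarrow> ('s::finite \<Rightarrow> (nat ^ 'd \<Rightarrow>\<^sub>0 real)) \<Rightarrow>
     (real ^ 's) \<times> real \<times> (nat ^ 'd \<Rightarrow> nat ^ 'd \<Rightarrow> real) \<Rightarrow> bool" where
  "sdp_feasible h g = (\<lambda>(l, \<gamma>, Q).
     (\<forall>j. 0 \<le> l $ j) \<and>
     psd_on (mindices (sdp_order g div 2)) Q \<and>
     (\<forall>\<alpha>\<in>mindices (sdp_order g).
        Poly_Mapping.lookup h \<alpha> + (\<Sum>j\<in>UNIV. l $ j * Poly_Mapping.lookup (g j) \<alpha>)
          - \<gamma> * (if \<alpha> = 0 then 1 else 0)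
        = trace_prod_on (mindices (sdp_order g div 2)) Q (Bmat \<alpha>)))"

definition sdp_objective ::
  "(real ^ 's) \<times> real \<times> (nat ^ 'd \<Rightarrow> nat ^ 'd \<Rightarrow> real) \<Rightarrow> real" where
  "sdp_objective = (\<lambda>(l, \<gamma>, Q). \<gamma>)"

text \<open>
  The moment vector \<open>y\<close> is a function on all multi-indices of which only the entries of degree
  at most \<open>\<omega>\<close> are ever used.
\<close>

definition mp_feasible ::
  "('s::finite \<Rightarrow> (nat ^ 'd \<Rightarrow>\<^sub>0 real)) \<Rightarrow> (nat ^ 'd \<Rightarrow> real) \<Rightarrow> bool" where
  "mp_feasible g y \<longleftrightarrow>
     (\<forall>j. (\<Sum>\<alpha>\<in>mindices (sdp_order g). Poly_Mapping.lookup (g j) \<alpha> * y \<alpha>) \<le> 0) \<and>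
     psd_on (mindices (sdp_order g div 2))
       (\<lambda>\<beta> \<gamma>. \<Sum>\<alpha>\<in>mindices (sdp_order g). y \<alpha> * Bmat \<alpha> \<beta> \<gamma>) \<and>
     y 0 = 1"

definition mp_objective ::
  "(nat ^ 'd \<Rightarrow>\<^sub>0 real) \<Rightarrow> ('s::finite \<Rightarrow> (nat ^ 'd \<Rightarrow>\<^sub>0 real)) \<Rightarrow> (nat ^ 'd \<Rightarrow> real) \<Rightarrow> real" where
  "mp_objective h g y = (\<Sum>\<alpha>\<in>mindices (sdp_order g). Poly_Mapping.lookup h \<alpha> * y \<alpha>)"

text \<open>Both optimal values are attained and they coincide.\<close>

definition max_sdp_eq_min_mp ::
  "(nat ^ 'd \<Rightarrow>\<^sub>0 real) \<Rightarrow> ('s::finite \<Rightarrow> (nat ^ 'd \<Rightarrow>\<^sub>0 real)) \<Rightarrow> bool" where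
  "max_sdp_eq_min_mp h g \<longleftrightarrow>
     (\<exists>z y. is_arg_max sdp_objective (sdp_feasible h g) z \<and>
            is_arg_min (mp_objective h g) (mp_feasible g) y \<and>
            sdp_objective z = mp_objective h g y)"

end

theory Submission imports Defs begin

text \<open>
  Let \<open>u\<close> be the vector of first moments of the optimal moment vector \<open>y\<close>, and \<open>L\<close> the linear
  functional on polynomials of degree at most \<open>\<omega>\<close> that sends \<open>x\<^sup>\<alpha>\<close> to \<open>y\<^sub>\<alpha>\<close>. Everything
  follows from Jensen's inequality \<open>p(u) \<le> L(p)\<close>, valid for every SOS-convex \<open>p\<close>
  (\<open>sos_convex_jensen\<close>) and for the squared distance (\<open>sq_dist_jensen\<close>), although \<open>L\<close> need not
  come from a measure. Applied to the constraints it gives \<open>g\<^sub>j(u) \<le> L(g\<^sub>j) \<le> 0\<close>, so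
  \<open>u \<in> D\<close>. Applied to \<open>h\<close> it gives \<open>h(u) \<le> L(h)\<close>. For \<open>x \<in> D\<close> the moments of the
  point mass at \<open>x\<close> are feasible, so minimality of \<open>y\<close> yields \<open>L(h) \<le> h(x)\<close>. Thus \<open>u\<close> is a
  point of \<open>D\<close> nearest to \<open>v\<close>, and it is the only one because \<open>D\<close> is closed and convex; the
  convexity again comes from Jensen's inequality, applied to mixtures of two point masses.

  Jensen's inequality is usually derived from the fact that \<open>p(x) - p(u) - \<nabla>p(u)\<^sup>T (x - u)\<close> is a
  sum of squares, which requires integrating a family of sums of squares and the closedness of a cone
  of polynomials. Here the integration is carried out after \<open>L\<close> has been applied, where it concerns
  only a real function \<open>\<phi>\<close> of one variable: \<open>\<phi>(t) = L(p(u + t (x - u)))\<close> satisfies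
  \<open>\<phi>'(0) = 0\<close> and \<open>\<phi>'' \<ge> 0\<close>, whence \<open>p(u) = \<phi>(0) \<le> \<phi>(1) = L(p)\<close>. To differentiate under
  \<open>L\<close> painlessly, \<open>L\<close> is written as a finite signed combination of point evaluations
  (\<open>signed_quadrature_exists\<close>).

  The remaining point is that the squares in \<open>\<phi>''\<close> are squares of polynomials of degree at most
  \<open>\<omega> / 2\<close>, the only ones on which the moment matrix guarantees positivity. This is a matter of
  growth: each square is bounded by a polynomial of degree at most \<open>\<omega>\<close> in \<open>x\<close>
  (\<open>second_line_derivative_growth\<close>), and growth bounds the degree by a Cauchy estimate
  (\<open>coefficient_eq_0_of_growth\<close>).
\<close>

section \<open>Signed quadrature for prescribed moments\<close>

text \<open>
  Lagrange interpolation at the nodes \<open>0, \<dots>, n\<close>. The basis polynomials are independent of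
  \<open>p\<close>, so every linear functional of \<open>p\<close>, such as a coefficient or the value of a derivative,
  becomes a fixed linear combination of the values \<open>p(0), \<dots>, p(n)\<close>.
\<close>

lemma lagrange_basis_exists:
  "\<exists>l :: nat \<Rightarrow> real poly. \<forall>p. degree p \<le> n \<longrightarrow> p = (\<Sum>i\<le>n. smult (poly p (real i)) (l i))"
proof -
  define m where "m i = (\<Prod>j\<in>{..n}-{i}. [:- real j, 1:])" for i
  define l where "l i = smult (1 / poly (m i) (real i)) (m i)" for i
  have m_poly: "poly (m i) x = (\<Prod>j\<in>{..n}-{i}. x - real j)" for i x
    by (simp add: m_def poly_prod)
  have deg: "degree (l i) \<le> n" if "i \<le> n" for i
  proof -
    have "degree (m i) \<le> (\<Sum>j\<in>{..n}-{i}. degree [:- real j, 1:])"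
      unfolding m_def by (rule degree_prod_sum_le[of "{..n}-{i}" "\<lambda>j. [:- real j, 1:]", unfolded o_def]) auto
    also have "\<dots> = n"
      using that by simp
    finally show ?thesis
      by (simp add: l_def)
  qed
  have l_poly: "poly (l i) (real j) = (if i = j then 1 else 0)" if "i \<le> n" "j \<le> n" for i j
  proof -
    have "poly (m i) (real i) \<noteq> 0"
      by (simp add: m_poly)
    moreover have "poly (m i) (real j) = 0" if "i \<noteq> j"
      using that \<open>j \<le> n\<close> by (simp add: m_poly)
    ultimately show ?thesis
      unfolding l_def by (cases "i = j") auto
  qed
  have "p = (\<Sum>i\<le>n. smult (poly p (real i)) (l i))" if "degree p \<le> n" for p
  proof (rule poly_eqI_degree[of "real ` {..n}"])
    show "poly p x = poly (\<Sum>i\<le>n. smult (poly p (real i)) (l i)) x" if "x \<in> real ` {..n}" for x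
      using that by (auto simp: poly_sum l_poly if_distrib sum.delta cong: if_cong)
    have "degree (\<Sum>i\<le>n. smult (poly p (real i)) (l i)) \<le> n"
      by (rule degree_sum_le) (auto intro: order_trans[OF degree_smult_le] deg)
    then show "degree (\<Sum>i\<le>n. smult (poly p (real i)) (l i)) < card (real ` {..n})"
      by (simp add: card_image)
    show "degree p < card (real ` {..n})"
      using \<open>degree p \<le> n\<close> by (simp add: card_image)
  qed
  then show ?thesis by blast
qed

lemma mindices_component_le:
  assumes "\<alpha> \<in> mindices N"
  shows "\<alpha> $ i \<le> N"
proof -
  have "\<alpha> $ i \<le> (\<Sum>i\<in>UNIV. \<alpha> $ i)"
    by (rule member_le_sum) auto
  then show ?thesis
    using assms by (simp add: mindices_def mindex_deg_def)
qed

text \<open>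
  Evaluations at the points of the grid \<open>{0, \<dots>, N}\<^sup>d\<close> span all linear functionals on the
  polynomials of degree at most \<open>N\<close>: the product of the one-dimensional coefficient functionals is
  the dual basis of the monomials. The weights \<open>c\<close> may be negative. The gain is that
  a moment sequence now acts on arbitrary functions, and that this action visibly commutes with differentiation in a parameter.
\<close>

lemma signed_quadrature_exists:
  fixes y :: "nat ^ 'd \<Rightarrow> real"
  shows "\<exists>(X :: (real ^ 'd) set) c. finite X \<and>
           (\<forall>\<alpha>\<in>mindices N. (\<Sum>x\<in>X. c x * monom_at \<alpha> x) = y \<alpha>)"
proof -
  obtain l :: "nat \<Rightarrow> real poly" where
    l: "\<And>p. degree p \<le> N \<Longrightarrow> p = (\<Sum>i\<le>N. smult (poly p (real i)) (l i))"
    using lagrange_basis_exists by blast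
  define G where "G = PiE (UNIV :: 'd set) (\<lambda>_. {..N})"
  define pt where "pt \<sigma> = (\<chi> i. real (\<sigma> i))" for \<sigma> :: "'d \<Rightarrow> nat"
  define c where "c \<sigma> = (\<Sum>\<alpha>\<in>mindices N. y \<alpha> * (\<Prod>i\<in>UNIV. coeff (l (\<sigma> i)) (\<alpha> $ i)))"
    for \<sigma>
  have finG: "finite G"
    unfolding G_def by (intro finite_PiE) auto
  have inj: "inj pt"
    by (rule injI) (auto simp: pt_def vec_eq_iff)
  \<comment> \<open>The coefficient functional of degree \<open>k\<close>, expressed by point values, on the monomial \<open>X\<^sup>m\<close>.\<close>
  have dual: "(\<Sum>i\<le>N. coeff (l i) k * real i ^ m) = (if k = m then 1 else 0)" if "m \<le> N" for k m
  proof -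
    have "coeff (monom 1 m) k = coeff (\<Sum>i\<le>N. smult (poly (monom 1 m) (real i)) (l i)) k"
      using l[of "monom 1 m"] that by (simp add: degree_monom_eq)
    then show ?thesis
      by (simp add: coeff_sum poly_monom mult.commute split: if_splits)
  qed
  have "(\<Sum>\<sigma>\<in>G. c \<sigma> * monom_at \<beta> (pt \<sigma>)) = y \<beta>" if "\<beta> \<in> mindices N" for \<beta>
  proof -
    have "(\<Sum>\<sigma>\<in>G. c \<sigma> * monom_at \<beta> (pt \<sigma>)) =
        (\<Sum>\<alpha>\<in>mindices N. y \<alpha> *
           (\<Sum>\<sigma>\<in>G. \<Prod>i\<in>UNIV. coeff (l (\<sigma> i)) (\<alpha> $ i) * real (\<sigma> i) ^ (\<beta> $ i)))"
      unfolding c_def sum_distrib_right sum_distrib_left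
      by (subst sum.swap) (simp add: monom_at_def pt_def prod.distrib mult.assoc)
    also have "\<dots> = (\<Sum>\<alpha>\<in>mindices N. y \<alpha> *
        (\<Prod>i\<in>UNIV. \<Sum>j\<le>N. coeff (l j) (\<alpha> $ i) * real j ^ (\<beta> $ i)))"
      unfolding G_def by (subst prod_sum_PiE) auto
    also have "\<dots> = (\<Sum>\<alpha>\<in>mindices N. y \<alpha> * (\<Prod>i\<in>UNIV. if \<alpha> $ i = \<beta> $ i then 1 else 0))"
      using that by (simp add: dual mindices_component_le)
    also have "\<dots> = (\<Sum>\<alpha>\<in>mindices N. if \<alpha> = \<beta> then y \<alpha> else 0)"
    proof (intro sum.cong refl)
      fix \<alpha> :: "nat ^ 'd"
      show "y \<alpha> * (\<Prod>i\<in>UNIV. if \<alpha> $ i = \<beta> $ i then 1 else 0) = (if \<alpha> = \<beta> then y \<alpha> else 0)"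
      proof (cases "\<alpha> = \<beta>")
        case False
        then obtain i where "\<alpha> $ i \<noteq> \<beta> $ i"
          by (auto simp: vec_eq_iff)
        then have "(\<Prod>i\<in>UNIV. if \<alpha> $ i = \<beta> $ i then 1 else (0::real)) = 0"
          by (intro prod_zero) auto
        then show ?thesis
          using False by simp
      qed simp
    qed
    also have "\<dots> = y \<beta>"
      using that by (simp add: finite_mindices)
    finally show ?thesis .
  qed
  then have "\<forall>\<beta>\<in>mindices N. (\<Sum>x\<in>pt ` G. c (inv pt x) * monom_at \<beta> x) = y \<beta>"
    using inj by (simp add: sum.reindex inj_on_subset[OF inj])
  moreover have "finite (pt ` G)"
    using finG by simp
  ultimately show ?thesis
    by (intro exI[of _ "pt ` G"] exI[of _ "\<lambda>x. c (inv pt x)"] conjI)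
qed

section \<open>Monomial expansions and growth\<close>

lemma monom_at_add: "monom_at (\<alpha> + \<beta>) x = monom_at \<alpha> x * monom_at \<beta> x"
  by (simp add: monom_at_def power_add prod.distrib)

lemma monom_at_zero [simp]: "monom_at 0 x = 1"
  by (simp add: monom_at_def)

lemma monom_at_axis: "monom_at (axis i 1) x = x $ i"
proof -
  have "monom_at (axis i 1) x = (\<Prod>j\<in>UNIV. if j = i then x $ j else 1)"
    unfolding monom_at_def by (intro prod.cong) (auto simp: axis_def)
  then show ?thesis
    by simp
qed

lemma mindex_deg_axis: "mindex_deg (axis i 1 :: nat ^ 'd) = 1"
proof -
  have "mindex_deg (axis i 1 :: nat ^ 'd) = (\<Sum>j\<in>UNIV. if j = i then 1 else 0)"
    unfolding mindex_deg_def by (intro sum.cong) (auto simp: axis_def)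
  then show ?thesis
    by simp
qed

lemma mindex_deg_zero [simp]: "mindex_deg 0 = 0"
  by (simp add: mindex_deg_def)

lemma monom_at_scaleR: "monom_at \<alpha> (r *\<^sub>R x) = r ^ mindex_deg \<alpha> * monom_at \<alpha> x"
  by (simp add: monom_at_def mindex_deg_def power_mult_distrib prod.distrib power_sum)

lemma abs_monom_at_le: "\<bar>monom_at \<alpha> x\<bar> \<le> (1 + norm x) ^ mindex_deg \<alpha>"
proof -
  have "\<bar>monom_at \<alpha> x\<bar> = (\<Prod>i\<in>UNIV. \<bar>x $ i\<bar> ^ (\<alpha> $ i))"
    by (simp add: monom_at_def abs_prod power_abs)
  also have "\<dots> \<le> (\<Prod>i\<in>UNIV. (1 + norm x) ^ (\<alpha> $ i))"
    by (intro prod_mono conjI power_mono)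
      (auto intro: order_trans[OF component_le_norm_cart])
  finally show ?thesis
    by (simp add: mindex_deg_def power_sum)
qed

text \<open>
  The family \<open>a\<close> may repeat multi-indices; this is what lets sums and products of expansions be
  indexed by disjoint unions and cartesian products.
\<close>

lemma monomial_family_regroup:
  assumes "finite K"
  shows "\<exists>N c. \<forall>x. (\<Sum>k\<in>K. b k * monom_at (a k) x) = (\<Sum>\<alpha>\<in>mindices N. c \<alpha> * monom_at \<alpha> x)"
proof -
  define N where "N = Max (insert 0 (mindex_deg ` a ` K))"
  define c where "c \<alpha> = (\<Sum>k | k \<in> K \<and> a k = \<alpha>. b k)" for \<alpha>
  have "a ` K \<subseteq> mindices N"
    using assms by (auto simp: mindices_def N_def)
  then have "(\<Sum>k\<in>K. b k * monom_at (a k) x)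
      = (\<Sum>\<alpha>\<in>mindices N. \<Sum>k | k \<in> K \<and> a k = \<alpha>. b k * monom_at (a k) x)" for x
    using sum.group[OF assms finite_mindices, of a N "\<lambda>k. b k * monom_at (a k) x"] by simp
  also have "(\<Sum>\<alpha>\<in>mindices N. \<Sum>k | k \<in> K \<and> a k = \<alpha>. b k * monom_at (a k) x)
      = (\<Sum>\<alpha>\<in>mindices N. c \<alpha> * monom_at \<alpha> x)" for x
    by (simp add: c_def sum_distrib_right)
  finally show ?thesis
    by blast
qed

lemma real_polynomial_function_imp_monomials:
  fixes f :: "real ^ 'd \<Rightarrow> real"
  assumes "real_polynomial_function f"
  shows "\<exists>N c. \<forall>x. f x = (\<Sum>\<alpha>\<in>mindices N. c \<alpha> * monom_at \<alpha> x)"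
  using assms
proof (induction rule: real_polynomial_function.induct)
  case (linear f)
  then interpret bounded_linear f .
  have eq: "f x = (\<Sum>i\<in>UNIV. f (axis i 1) * monom_at (axis i 1) x)" for x
  proof -
    have "f x = f (\<Sum>i\<in>UNIV. x $ i *\<^sub>R axis i 1)"
      by (simp add: basis_expansion scalar_mult_eq_scaleR[symmetric])
    also have "\<dots> = (\<Sum>i\<in>UNIV. x $ i * f (axis i 1))"
      by (simp add: sum scaleR)
    finally show ?thesis
      unfolding monom_at_axis by (simp add: mult.commute)
  qed
  show ?case
    by (subst eq) (rule monomial_family_regroup, simp)
next
  case (const k)
  show ?case
    using monomial_family_regroup[of "{0::nat}" "\<lambda>_. k" "\<lambda>_. 0 :: nat ^ 'd"] by simp
next
  case (add f g)
  then obtain N c M e where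
    "\<And>x. f x = (\<Sum>\<alpha>\<in>mindices N. c \<alpha> * monom_at \<alpha> x)"
    "\<And>x. g x = (\<Sum>\<alpha>\<in>mindices M. e \<alpha> * monom_at \<alpha> x)"
    by blast
  then have "f x + g x = (\<Sum>k\<in>mindices N <+> mindices M.
      case_sum c e k * monom_at (case_sum id id k) x)" for x
    by (simp add: sum.Plus finite_mindices)
  then show ?case
    using monomial_family_regroup[of "mindices N <+> mindices M :: ((nat ^ 'd) + (nat ^ 'd)) set"
        "case_sum c e" "case_sum id id"]
    by (simp add: finite_mindices)
next
  case (mult f g)
  then obtain N c M e where
    "\<And>x. f x = (\<Sum>\<alpha>\<in>mindices N. c \<alpha> * monom_at \<alpha> x)"
    "\<And>x. g x = (\<Sum>\<alpha>\<in>mindices M. e \<alpha> * monom_at \<alpha> x)"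
    by blast
  then have "f x * g x = (\<Sum>k\<in>mindices N \<times> mindices M.
      (c (fst k) * e (snd k)) * monom_at (fst k + snd k) x)" for x
    by (simp add: sum_product sum.cartesian_product case_prod_beta monom_at_add ac_simps)
  then show ?case
    using monomial_family_regroup[of "mindices N \<times> mindices M :: ((nat ^ 'd) \<times> (nat ^ 'd)) set"
        "\<lambda>k. c (fst k) * e (snd k)" "\<lambda>k. fst k + snd k"]
    by (simp add: finite_mindices)
qed

text \<open>
  A Cauchy estimate. The coefficient \<open>a \<alpha>\<close> is a fixed signed combination of values of \<open>f\<close> at
  finitely many points \<open>x\<close>. Taking the values at the dilated points \<open>R x\<close> instead multiplies
  the result by \<open>R\<close> to the power of the degree of \<open>\<alpha>\<close>, while the values of \<open>f\<close> grow only like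
  \<open>R\<^sup>m\<close>. The lemma takes the place of arguments about leading forms that cannot cancel.
\<close>

lemma coefficient_eq_0_of_growth:
  fixes f :: "real ^ 'd \<Rightarrow> real"
  assumes f: "\<And>x. f x = (\<Sum>\<alpha>\<in>mindices N. a \<alpha> * monom_at \<alpha> x)"
    and bound: "\<And>x. \<bar>f x\<bar> \<le> C * (1 + norm x) ^ m"
    and \<alpha>: "\<alpha> \<in> mindices N" "m < mindex_deg \<alpha>"
  shows "a \<alpha> = 0"
proof (rule ccontr)
  assume nz: "a \<alpha> \<noteq> 0"
  obtain X :: "(real ^ 'd) set" and c where X: "finite X"
    and c: "\<And>\<beta>. \<beta> \<in> mindices N \<Longrightarrow> (\<Sum>x\<in>X. c x * monom_at \<beta> x) = (if \<beta> = \<alpha> then 1 else 0)"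
    using signed_quadrature_exists[of N "\<lambda>\<beta>. if \<beta> = \<alpha> then 1 else 0"] by blast
  have C: "0 \<le> C"
    using bound[of 0] by simp
  define K where "K = (\<Sum>x\<in>X. \<bar>c x\<bar> * (C * (1 + norm x) ^ m))"
  have est: "\<bar>a \<alpha>\<bar> * R \<le> K" if R: "1 \<le> R" for R :: real
  proof -
    have "(\<Sum>x\<in>X. c x * f (R *\<^sub>R x))
        = (\<Sum>\<beta>\<in>mindices N. a \<beta> * R ^ mindex_deg \<beta> * (\<Sum>x\<in>X. c x * monom_at \<beta> x))"
      unfolding f monom_at_scaleR sum_distrib_left by (subst sum.swap) (simp add: ac_simps)
    also have "\<dots> = (\<Sum>\<beta>\<in>mindices N. if \<beta> = \<alpha> then a \<beta> * R ^ mindex_deg \<beta> else 0)"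
      by (intro sum.cong) (auto simp: c)
    also have "\<dots> = a \<alpha> * R ^ mindex_deg \<alpha>"
      using \<alpha> by (simp add: finite_mindices)
    finally have "\<bar>a \<alpha>\<bar> * R ^ mindex_deg \<alpha> = \<bar>\<Sum>x\<in>X. c x * f (R *\<^sub>R x)\<bar>"
      using R by (simp add: abs_mult)
    also have "\<dots> \<le> (\<Sum>x\<in>X. \<bar>c x\<bar> * \<bar>f (R *\<^sub>R x)\<bar>)"
      by (rule order_trans[OF sum_abs]) (simp add: abs_mult)
    also have "\<dots> \<le> (\<Sum>x\<in>X. \<bar>c x\<bar> * (C * (R * (1 + norm x)) ^ m))"
    proof (intro sum_mono mult_left_mono)
      fix x :: "real ^ 'd"
      have "(1 + norm (R *\<^sub>R x)) ^ m \<le> (R * (1 + norm x)) ^ m"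
        using R by (intro power_mono) (auto simp: algebra_simps)
      then show "\<bar>f (R *\<^sub>R x)\<bar> \<le> C * (R * (1 + norm x)) ^ m"
        using bound[of "R *\<^sub>R x"] C by (meson mult_left_mono order_trans)
    qed auto
    also have "\<dots> = K * R ^ m"
      unfolding K_def by (simp add: sum_distrib_left sum_distrib_right power_mult_distrib ac_simps)
    finally have "\<bar>a \<alpha>\<bar> * R ^ mindex_deg \<alpha> \<le> K * R ^ m" .
    moreover have "\<bar>a \<alpha>\<bar> * R ^ Suc m \<le> \<bar>a \<alpha>\<bar> * R ^ mindex_deg \<alpha>"
      using R \<alpha> by (intro mult_left_mono power_increasing) auto
    ultimately have "(\<bar>a \<alpha>\<bar> * R) * R ^ m \<le> K * R ^ m"
      by (simp add: ac_simps)
    then show ?thesis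
      using R by (simp add: mult_le_cancel_right)
  qed
  \<comment> \<open>At \<open>R = 1 + K / \<bar>a \<alpha>\<bar>\<close> the estimate reads \<open>\<bar>a \<alpha>\<bar> + K \<le> K\<close>.\<close>
  have "K \<ge> 0"
    using C by (auto simp: K_def intro!: sum_nonneg)
  then have "\<bar>a \<alpha>\<bar> * (1 + K / \<bar>a \<alpha>\<bar>) \<le> K"
    by (intro est) auto
  then show False
    using nz by (simp add: algebra_simps)
qed

lemma poly_at_eq_sum_mindices:
  assumes "Poly_Mapping.keys p \<subseteq> mindices N"
  shows "poly_at p x = (\<Sum>\<alpha>\<in>mindices N. Poly_Mapping.lookup p \<alpha> * monom_at \<alpha> x)"
  unfolding poly_at_def
  using assms by (intro sum.mono_neutral_left finite_mindices) (auto simp: in_keys_iff)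

lemma keys_subset_mindices:
  assumes "poly_deg p \<le> N"
  shows "Poly_Mapping.keys p \<subseteq> mindices N"
proof
  fix \<alpha>
  assume "\<alpha> \<in> Poly_Mapping.keys p"
  then have "mindex_deg \<alpha> \<le> poly_deg p"
    unfolding poly_deg_def by (intro Max_ge) auto
  then show "\<alpha> \<in> mindices N"
    using assms by (simp add: mindices_def)
qed

section \<open>Derivatives of polynomials along lines\<close>

lemma real_polynomial_function_component:
  "real_polynomial_function (\<lambda>x :: real ^ 'd. x $ i)"
  by (intro real_polynomial_function.intros(1) bounded_linear_vec_nth)

lemma real_polynomial_function_poly_at: "real_polynomial_function (poly_at p)"
  unfolding poly_at_def[abs_def] monom_at_def
  by (intro real_polynomial_function_sum real_polynomial_function.intros(4)
      real_polynomial_function.intros(2) real_polynomial_function_prod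
      real_polynomial_function_power real_polynomial_function_component) auto

lemma real_polynomial_function_on_line:
  fixes f :: "real ^ 'd \<Rightarrow> real"
  assumes "real_polynomial_function f"
  shows "real_polynomial_function (\<lambda>x. f (u + s *\<^sub>R (x - u)))"
proof -
  have "polynomial_function (\<lambda>x. u + s *\<^sub>R (x - u))"
    by (intro polynomial_function_add polynomial_function_const polynomial_function_cmul
        polynomial_function_diff polynomial_function_id)
  then show ?thesis
    using real_polynomial_function_compose[OF _ assms] by (simp add: o_def)
qed

lemma real_polynomial_function_has_derivative:
  fixes f :: "'a :: euclidean_space \<Rightarrow> real"
  assumes "real_polynomial_function f"
  shows "(f has_derivative frechet_derivative f (at x)) (at x)"
  using differentiable_at_real_polynomial_function[OF assms] by (simp add: frechet_derivative_works)

text \<open>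
  Directional derivatives are polynomial again, so that they can be differentiated once more; the
  Hessian needs exactly this.
\<close>

lemma real_polynomial_function_frechet_derivative:
  fixes f :: "real ^ 'd \<Rightarrow> real"
  assumes "real_polynomial_function f"
  shows "real_polynomial_function (\<lambda>x. frechet_derivative f (at x) z)"
  using assms
proof (induction rule: real_polynomial_function.induct)
  case (linear f)
  then have "frechet_derivative f (at x) = f" for x
    by (metis bounded_linear_imp_has_derivative frechet_derivative_at)
  then show ?case
    by (simp add: real_polynomial_function.intros(2))
next
  case (const c)
  then show ?case
    by (simp add: real_polynomial_function.intros(2))
next
  case (add f g)
  have "frechet_derivative (\<lambda>x. f x + g x) (at x) z
      = frechet_derivative f (at x) z + frechet_derivative g (at x) z" for x
    by (rule sym, rule fun_cong[OF frechet_derivative_at], rule has_derivative_add)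
      (intro real_polynomial_function_has_derivative add.hyps)+
  then show ?case
    using add.IH by (simp add: real_polynomial_function.intros(3))
next
  case (mult f g)
  have "frechet_derivative (\<lambda>x. f x * g x) (at x) z
      = f x * frechet_derivative g (at x) z + frechet_derivative f (at x) z * g x" for x
    by (rule sym, rule fun_cong[OF frechet_derivative_at], rule has_derivative_mult)
      (intro real_polynomial_function_has_derivative mult.hyps)+
  then show ?case
    using mult by (simp add: real_polynomial_function.intros(3) real_polynomial_function.intros(4))
qed

lemma real_polynomial_function_partial_deriv:
  "real_polynomial_function f \<Longrightarrow> real_polynomial_function (partial_deriv i f)"
  using real_polynomial_function_frechet_derivative[of f "axis i 1"]
  by (simp add: partial_deriv_def[abs_def])

lemma DERIV_along_line:
  fixes f :: "real ^ 'd \<Rightarrow> real"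
  assumes "real_polynomial_function f"
  shows "((\<lambda>t. f (u + t *\<^sub>R z)) has_real_derivative
           (\<Sum>i\<in>UNIV. z $ i * partial_deriv i f (u + t *\<^sub>R z))) (at t)"
proof -
  define D where "D = frechet_derivative f (at (u + t *\<^sub>R z))"
  have D: "(f has_derivative D) (at (u + t *\<^sub>R z))"
    unfolding D_def by (rule real_polynomial_function_has_derivative[OF assms])
  interpret D: bounded_linear D
    using D by (rule has_derivative_bounded_linear)
  have "D z = D (\<Sum>i\<in>UNIV. z $ i *\<^sub>R axis i 1)"
    by (simp add: basis_expansion scalar_mult_eq_scaleR[symmetric])
  also have "\<dots> = (\<Sum>i\<in>UNIV. z $ i * D (axis i 1))"
    by (simp add: D.sum D.scaleR)
  finally have "D z = (\<Sum>i\<in>UNIV. z $ i * partial_deriv i f (u + t *\<^sub>R z))"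
    unfolding partial_deriv_def D_def .
  moreover have "((\<lambda>t. f (u + t *\<^sub>R z)) has_derivative (\<lambda>h. D (h *\<^sub>R z))) (at t)"
    by (rule has_derivative_compose[of "\<lambda>t. u + t *\<^sub>R z" _ _ _ f, OF _ D])
      (auto intro!: derivative_eq_intros)
  ultimately show ?thesis
    by (simp add: has_field_derivative_def D.scaleR mult_commute_abs)
qed

lemma DERIV2_along_line:
  fixes f :: "real ^ 'd \<Rightarrow> real"
  assumes "real_polynomial_function f"
  shows "((\<lambda>t. \<Sum>i\<in>UNIV. z $ i * partial_deriv i f (u + t *\<^sub>R z)) has_real_derivative
           (\<Sum>i\<in>UNIV. \<Sum>j\<in>UNIV. z $ i * z $ j * hessian f (u + t *\<^sub>R z) $ i $ j)) (at t)"
proof -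
  have "((\<lambda>t. \<Sum>j\<in>UNIV. z $ j * partial_deriv j f (u + t *\<^sub>R z)) has_real_derivative
      (\<Sum>j\<in>UNIV. z $ j * (\<Sum>i\<in>UNIV. z $ i * partial_deriv i (partial_deriv j f) (u + t *\<^sub>R z))))
      (at t)"
    by (intro DERIV_sum DERIV_cmult DERIV_along_line real_polynomial_function_partial_deriv assms)
  also have "(\<Sum>j\<in>UNIV. z $ j * (\<Sum>i\<in>UNIV. z $ i * partial_deriv i (partial_deriv j f) (u + t *\<^sub>R z)))
      = (\<Sum>i\<in>UNIV. \<Sum>j\<in>UNIV. z $ i * z $ j * hessian f (u + t *\<^sub>R z) $ i $ j)"
    unfolding sum_distrib_left by (subst sum.swap) (simp add: hessian_def ac_simps)
  finally show ?thesis .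
qed

lemma poly_at_growth:
  assumes "Poly_Mapping.keys p \<subseteq> mindices N"
  shows "\<exists>C\<ge>0. \<forall>x. \<bar>poly_at p x\<bar> \<le> C * (1 + norm x) ^ N"
proof -
  define C where "C = (\<Sum>\<alpha>\<in>mindices N. \<bar>Poly_Mapping.lookup p \<alpha>\<bar>)"
  have "\<bar>poly_at p x\<bar> \<le> C * (1 + norm x) ^ N" for x
  proof -
    have "\<bar>poly_at p x\<bar> \<le> (\<Sum>\<alpha>\<in>mindices N. \<bar>Poly_Mapping.lookup p \<alpha>\<bar> * \<bar>monom_at \<alpha> x\<bar>)"
      unfolding poly_at_eq_sum_mindices[OF assms]
      by (rule order_trans[OF sum_abs]) (simp add: abs_mult)
    also have "\<dots> \<le> (\<Sum>\<alpha>\<in>mindices N. \<bar>Poly_Mapping.lookup p \<alpha>\<bar> * (1 + norm x) ^ N)"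
    proof (intro sum_mono mult_left_mono)
      fix \<alpha> :: "nat ^ 'a"
      assume "\<alpha> \<in> mindices N"
      then have "(1 + norm x) ^ mindex_deg \<alpha> \<le> (1 + norm x) ^ N"
        by (intro power_increasing) (auto simp: mindices_def)
      then show "\<bar>monom_at \<alpha> x\<bar> \<le> (1 + norm x) ^ N"
        using abs_monom_at_le order_trans by blast
    qed auto
    finally show ?thesis
      by (simp add: C_def sum_distrib_right)
  qed
  moreover have "C \<ge> 0"
    by (auto simp: C_def intro: sum_nonneg)
  ultimately show ?thesis
    by blast
qed

lemma poly_at_along_line_poly:
  assumes "Poly_Mapping.keys p \<subseteq> mindices N"
  shows "\<exists>P. degree P \<le> N \<and> (\<forall>t. poly P t = poly_at p (u + t *\<^sub>R z))"
proof -
  define M where "M \<alpha> = (\<Prod>i\<in>UNIV. [:u $ i, z $ i:] ^ (\<alpha> $ i))" for \<alpha> :: "nat ^ 'a"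
  define P where "P = (\<Sum>\<alpha>\<in>mindices N. smult (Poly_Mapping.lookup p \<alpha>) (M \<alpha>))"
  have degM: "degree (M \<alpha>) \<le> mindex_deg \<alpha>" for \<alpha>
  proof -
    have "degree (M \<alpha>) \<le> (\<Sum>i\<in>UNIV. degree ([:u $ i, z $ i:] ^ (\<alpha> $ i)))"
      unfolding M_def
      by (rule degree_prod_sum_le[of UNIV "\<lambda>i. [:u $ i, z $ i:] ^ (\<alpha> $ i)", unfolded o_def]) auto
    also have "\<dots> \<le> (\<Sum>i\<in>UNIV. \<alpha> $ i)"
    proof (rule sum_mono)
      fix i
      have "degree ([:u $ i, z $ i:] ^ (\<alpha> $ i)) \<le> degree [:u $ i, z $ i:] * \<alpha> $ i"
        by (rule degree_power_le)
      also have "\<dots> \<le> 1 * \<alpha> $ i"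
        by (intro mult_right_mono) auto
      finally show "degree ([:u $ i, z $ i:] ^ (\<alpha> $ i)) \<le> \<alpha> $ i"
        by simp
    qed
    finally show ?thesis
      by (simp add: mindex_deg_def)
  qed
  have "degree P \<le> N"
    unfolding P_def
    by (intro degree_sum_le finite_mindices order_trans[OF degree_smult_le] order_trans[OF degM])
      (simp add: mindices_def)
  moreover have "poly P t = poly_at p (u + t *\<^sub>R z)" for t
    by (simp add: P_def M_def poly_sum poly_prod poly_at_eq_sum_mindices[OF assms] monom_at_def)
  ultimately show ?thesis
    by blast
qed

text \<open>
  The restriction of a polynomial of degree at most \<open>N\<close> to the line through \<open>u\<close> and \<open>x\<close> is a
  polynomial in one variable of degree at most \<open>N\<close>. By interpolation, its second derivative at
  \<open>s\<close> is a combination, with weights depending only on \<open>s\<close>, of its values at the parameters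
  \<open>0, \<dots>, N\<close>, and each of these values grows at most like the \<open>N\<close>-th power in \<open>x\<close>. The
  growth bound is all that is needed to control the degrees of the summands in a sum-of-squares
  representation of the Hessian.
\<close>

lemma second_line_derivative_growth:
  fixes p :: "nat ^ 'd \<Rightarrow>\<^sub>0 real"
  assumes p: "Poly_Mapping.keys p \<subseteq> mindices N"
  shows "\<exists>C. \<forall>x. \<bar>\<Sum>i\<in>UNIV. \<Sum>j\<in>UNIV.
      (x - u) $ i * (x - u) $ j * hessian (poly_at p) (u + s *\<^sub>R (x - u)) $ i $ j\<bar>
      \<le> C * (1 + norm x) ^ N"
proof -
  define H where "H x = (\<Sum>i\<in>UNIV. \<Sum>j\<in>UNIV.
      (x - u) $ i * (x - u) $ j * hessian (poly_at p) (u + s *\<^sub>R (x - u)) $ i $ j)" for x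
  obtain l :: "nat \<Rightarrow> real poly" where
    l: "\<And>P. degree P \<le> N \<Longrightarrow> P = (\<Sum>k\<le>N. smult (poly P (real k)) (l k))"
    using lagrange_basis_exists by blast
  define b where "b k = poly (pderiv (pderiv (l k))) s" for k
  obtain C where C: "C \<ge> 0" "\<And>x. \<bar>poly_at p x\<bar> \<le> C * (1 + norm x) ^ N"
    using poly_at_growth[OF p] by blast
  \<comment> \<open>\<open>K k\<close> bounds the ratio of \<open>1 + \<parallel>u + k (x - u)\<parallel>\<close> to \<open>1 + \<parallel>x\<parallel>\<close>.\<close>
  define K where "K k = 1 + \<bar>1 - real k\<bar> * norm u + real k" for k
  have H_eq: "H x = (\<Sum>k\<le>N. poly_at p (u + real k *\<^sub>R (x - u)) * b k)" for x
  proof -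
    obtain P where P: "degree P \<le> N" "\<And>t. poly P t = poly_at p (u + t *\<^sub>R (x - u))"
      using poly_at_along_line_poly[OF p] by blast
    note rp = real_polynomial_function_poly_at[of p]
    have "poly (pderiv P) t
        = (\<Sum>i\<in>UNIV. (x - u) $ i * partial_deriv i (poly_at p) (u + t *\<^sub>R (x - u)))" for t
      using DERIV_unique[OF poly_DERIV[of P t]] DERIV_along_line[OF rp, of u "x - u" t]
      by (simp add: P(2)[symmetric])
    then have "poly (pderiv (pderiv P)) s = H x"
      using DERIV_unique[OF poly_DERIV[of "pderiv P" s]] DERIV2_along_line[OF rp, of "x - u" u s]
      by (simp add: H_def)
    moreover have "pderiv (pderiv P) = (\<Sum>k\<le>N. smult (poly P (real k)) (pderiv (pderiv (l k))))"
      by (subst l[OF P(1)]) (simp add: higher_pderiv_sum[of 1, simplified] pderiv_smult)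
    ultimately show ?thesis
      by (simp add: P(2) b_def poly_sum)
  qed
  have "\<bar>H x\<bar> \<le> (\<Sum>k\<le>N. C * K k ^ N * \<bar>b k\<bar>) * (1 + norm x) ^ N" for x
  proof -
    have "\<bar>poly_at p (u + real k *\<^sub>R (x - u))\<bar> \<le> C * K k ^ N * (1 + norm x) ^ N" for k
    proof -
      have "u + real k *\<^sub>R (x - u) = (1 - real k) *\<^sub>R u + real k *\<^sub>R x"
        by (simp add: algebra_simps)
      then have "norm (u + real k *\<^sub>R (x - u)) \<le> \<bar>1 - real k\<bar> * norm u + real k * norm x"
        by (metis abs_of_nat norm_scaleR norm_triangle_ineq)
      also have "1 + \<dots> \<le> K k * (1 + norm x)"
      proof -
        have "0 \<le> norm x + real k + \<bar>1 - real k\<bar> * norm u * norm x"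
          by simp
        then show ?thesis
          unfolding K_def by (simp add: algebra_simps)
      qed
      finally have "1 + norm (u + real k *\<^sub>R (x - u)) \<le> K k * (1 + norm x)"
        by simp
      then have "(1 + norm (u + real k *\<^sub>R (x - u))) ^ N \<le> (K k * (1 + norm x)) ^ N"
        by (intro power_mono) auto
      then have "C * (1 + norm (u + real k *\<^sub>R (x - u))) ^ N \<le> C * (K k * (1 + norm x)) ^ N"
        using C(1) by (rule mult_left_mono)
      then show ?thesis
        using C(2)[of "u + real k *\<^sub>R (x - u)"] by (simp add: power_mult_distrib mult.assoc)
    qed
    then have "(\<Sum>k\<le>N. \<bar>poly_at p (u + real k *\<^sub>R (x - u))\<bar> * \<bar>b k\<bar>)
        \<le> (\<Sum>k\<le>N. C * K k ^ N * (1 + norm x) ^ N * \<bar>b k\<bar>)"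
      by (intro sum_mono mult_right_mono) auto
    moreover have "\<bar>H x\<bar> \<le> (\<Sum>k\<le>N. \<bar>poly_at p (u + real k *\<^sub>R (x - u))\<bar> * \<bar>b k\<bar>)"
      unfolding H_eq by (rule order_trans[OF sum_abs]) (simp add: abs_mult)
    moreover have "(\<Sum>k\<le>N. C * K k ^ N * (1 + norm x) ^ N * \<bar>b k\<bar>)
        = (\<Sum>k\<le>N. C * K k ^ N * \<bar>b k\<bar>) * (1 + norm x) ^ N"
      unfolding sum_distrib_right by (intro sum.cong refl) (simp only: ac_simps)
    ultimately show ?thesis
      by linarith
  qed
  then show ?thesis
    unfolding H_def by blast
qed

section \<open>Jensen's inequality for pseudo-moments\<close>

lemma Bmat_moment:
  assumes "even w" "\<beta> \<in> mindices (w div 2)" "\<gamma> \<in> mindices (w div 2)"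
  shows "(\<Sum>\<alpha>\<in>mindices w. y \<alpha> * Bmat \<alpha> \<beta> \<gamma>) = y (\<beta> + \<gamma>)"
proof -
  have "\<beta> + \<gamma> \<in> mindices w"
    using assms by (auto simp: mindices_def mindex_deg_def sum.distrib elim!: evenE)
  moreover have "y \<alpha> * Bmat \<alpha> \<beta> \<gamma> = (if \<alpha> = \<beta> + \<gamma> then y \<alpha> else 0)" for \<alpha>
    by (auto simp: Bmat_def Poly_Mapping.mult_single Poly_Mapping.lookup_single when_def)
  ultimately show ?thesis
    by (simp add: finite_mindices)
qed

definition psd_moments :: "nat \<Rightarrow> (nat ^ 'd \<Rightarrow> real) \<Rightarrow> bool" where
  "psd_moments w y \<longleftrightarrow>
     psd_on (mindices (w div 2)) (\<lambda>\<beta> \<gamma>. \<Sum>\<alpha>\<in>mindices w. y \<alpha> * Bmat \<alpha> \<beta> \<gamma>)"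

lemma psd_moments_iff:
  assumes "even w"
  shows "psd_moments w y \<longleftrightarrow> (\<forall>a. 0 \<le>
    (\<Sum>\<beta>\<in>mindices (w div 2). \<Sum>\<gamma>\<in>mindices (w div 2). a \<beta> * y (\<beta> + \<gamma>) * a \<gamma>))"
proof -
  let ?M = "\<lambda>\<beta> \<gamma>. \<Sum>\<alpha>\<in>mindices w. y \<alpha> * Bmat \<alpha> \<beta> \<gamma>" and ?I = "mindices (w div 2)"
  have "\<forall>\<beta>\<in>?I. \<forall>\<gamma>\<in>?I. ?M \<beta> \<gamma> = ?M \<gamma> \<beta>"
    using assms by (auto simp: Bmat_moment add.commute)
  moreover have "(\<Sum>\<beta>\<in>?I. \<Sum>\<gamma>\<in>?I. a \<beta> * ?M \<beta> \<gamma> * a \<gamma>)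
      = (\<Sum>\<beta>\<in>?I. \<Sum>\<gamma>\<in>?I. a \<beta> * y (\<beta> + \<gamma>) * a \<gamma>)" for a
    by (intro sum.cong refl) (simp only: Bmat_moment[OF assms])
  ultimately show ?thesis
    unfolding psd_moments_def psd_on_def by simp
qed

text \<open>
  The points \<open>X\<close> with the weights \<open>c\<close> represent the Riesz functional of the moment vector \<open>y\<close>
  on polynomials of degree at most \<open>w\<close>. In general there is no nonnegative measure behind \<open>y\<close>;
  positivity is available for squares of polynomials of degree at most \<open>w / 2\<close> only.
\<close>

locale moment_quadrature =
  fixes w :: nat and y :: "nat ^ 'd \<Rightarrow> real" and X :: "(real ^ 'd) set" and c :: "real ^ 'd \<Rightarrow> real"
  assumes even_w: "even w" and w_ge_2: "2 \<le> w"
    and y_zero: "y 0 = 1" and psd: "psd_moments w y"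
    and finite_X: "finite X"
    and moments: "\<And>\<alpha>. \<alpha> \<in> mindices w \<Longrightarrow> (\<Sum>x\<in>X. c x * monom_at \<alpha> x) = y \<alpha>"
begin

definition center :: "real ^ 'd" where
  "center = (\<chi> i. y (axis i 1))"

lemma weights_sum: "(\<Sum>x\<in>X. c x) = 1"
  using moments[of 0] y_zero by (simp add: mindices_def)

lemma centered: "(\<Sum>x\<in>X. c x * (x - center) $ i) = 0"
proof -
  have "(\<Sum>x\<in>X. c x * x $ i) = center $ i"
    using moments[of "axis i 1"] w_ge_2
    by (simp add: mindices_def mindex_deg_axis monom_at_axis center_def del: One_nat_def)
  moreover have "(\<Sum>x\<in>X. c x * (x - center) $ i)
      = (\<Sum>x\<in>X. c x * x $ i) - (\<Sum>x\<in>X. c x) * center $ i"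
    by (simp add: right_diff_distrib sum_subtractf sum_distrib_right)
  ultimately show ?thesis
    by (simp add: weights_sum)
qed

lemma quadrature_poly_at:
  assumes "Poly_Mapping.keys p \<subseteq> mindices w"
  shows "(\<Sum>x\<in>X. c x * poly_at p x) = (\<Sum>\<alpha>\<in>mindices w. Poly_Mapping.lookup p \<alpha> * y \<alpha>)"
proof -
  have "(\<Sum>x\<in>X. c x * poly_at p x)
      = (\<Sum>\<alpha>\<in>mindices w. Poly_Mapping.lookup p \<alpha> * (\<Sum>x\<in>X. c x * monom_at \<alpha> x))"
    unfolding poly_at_eq_sum_mindices[OF assms] sum_distrib_left
    by (subst sum.swap) (simp add: ac_simps)
  then show ?thesis
    by (simp add: moments)
qed

text \<open>
  The growth hypothesis forces \<open>q\<close> to have degree at most \<open>w / 2\<close>, whatever its presentation.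
  The weighted sum of \<open>q\<^sup>2\<close> is then the moment matrix evaluated at the coefficient vector of
  \<open>q\<close>.
\<close>

lemma quadrature_square_nonneg:
  assumes q: "real_polynomial_function q"
    and growth: "\<And>x. (q x)\<^sup>2 \<le> C * (1 + norm x) ^ w"
  shows "0 \<le> (\<Sum>x\<in>X. c x * (q x)\<^sup>2)"
proof -
  define m where "m = w div 2"
  have w: "w = 2 * m"
    using even_w by (simp add: m_def)
  obtain N a where a: "\<And>x. q x = (\<Sum>\<alpha>\<in>mindices N. a \<alpha> * monom_at \<alpha> x)"
    using real_polynomial_function_imp_monomials[OF q] by blast
  have "0 \<le> (q 0)\<^sup>2"
    by simp
  also have "\<dots> \<le> C"
    using growth[of 0] by simp
  finally have C: "0 \<le> C" .
  have "\<bar>q x\<bar> \<le> sqrt C * (1 + norm x) ^ m" for x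
  proof -
    have "(q x)\<^sup>2 \<le> (sqrt C * (1 + norm x) ^ m)\<^sup>2"
      using growth[of x] C by (simp add: w power_mult_distrib power_mult[symmetric] mult.commute)
    then show ?thesis
      using C by (simp add: abs_le_square_iff[symmetric])
  qed
  then have a_zero: "a \<alpha> = 0" if "\<alpha> \<in> mindices N" "m < mindex_deg \<alpha>" for \<alpha>
    using coefficient_eq_0_of_growth[OF a] that by blast
  define b where "b \<alpha> = (if \<alpha> \<in> mindices N then a \<alpha> else 0)" for \<alpha>
  have q_eq: "q x = (\<Sum>\<alpha>\<in>mindices m. b \<alpha> * monom_at \<alpha> x)" for x
    unfolding a
    by (rule sum.mono_neutral_cong)
      (auto simp: finite_mindices b_def intro!: a_zero, auto simp: mindices_def)
  have "(\<Sum>x\<in>X. c x * (q x)\<^sup>2) = (\<Sum>\<beta>\<in>mindices m. \<Sum>\<gamma>\<in>mindices m.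
      b \<beta> * (\<Sum>x\<in>X. c x * monom_at (\<beta> + \<gamma>) x) * b \<gamma>)"
  proof -
    have "c x * (q x)\<^sup>2 = (\<Sum>\<beta>\<in>mindices m. \<Sum>\<gamma>\<in>mindices m.
        b \<beta> * (c x * monom_at (\<beta> + \<gamma>) x) * b \<gamma>)" for x
      by (simp add: q_eq power2_eq_square sum_product sum_distrib_left monom_at_add ac_simps)
    then have "(\<Sum>x\<in>X. c x * (q x)\<^sup>2) = (\<Sum>x\<in>X. \<Sum>\<beta>\<in>mindices m. \<Sum>\<gamma>\<in>mindices m.
        b \<beta> * (c x * monom_at (\<beta> + \<gamma>) x) * b \<gamma>)"
      by simp
    also have "\<dots> = (\<Sum>\<beta>\<in>mindices m. \<Sum>x\<in>X. \<Sum>\<gamma>\<in>mindices m.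
        b \<beta> * (c x * monom_at (\<beta> + \<gamma>) x) * b \<gamma>)"
      by (rule sum.swap)
    also have "\<dots> = (\<Sum>\<beta>\<in>mindices m. \<Sum>\<gamma>\<in>mindices m. \<Sum>x\<in>X.
        b \<beta> * (c x * monom_at (\<beta> + \<gamma>) x) * b \<gamma>)"
      by (intro sum.cong refl sum.swap)
    finally show ?thesis
      by (simp add: sum_distrib_left sum_distrib_right)
  qed
  also have "\<dots> = (\<Sum>\<beta>\<in>mindices m. \<Sum>\<gamma>\<in>mindices m. b \<beta> * y (\<beta> + \<gamma>) * b \<gamma>)"
  proof (intro sum.cong refl)
    fix \<beta> \<gamma> :: "nat ^ 'd"
    assume "\<beta> \<in> mindices m" "\<gamma> \<in> mindices m"
    then have "\<beta> + \<gamma> \<in> mindices w"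
      by (simp add: mindices_def mindex_deg_def sum.distrib w)
    then show "b \<beta> * (\<Sum>x\<in>X. c x * monom_at (\<beta> + \<gamma>) x) * b \<gamma> = b \<beta> * y (\<beta> + \<gamma>) * b \<gamma>"
      by (simp add: moments)
  qed
  also have "\<dots> \<ge> 0"
    using psd unfolding psd_moments_iff[OF even_w] m_def by blast
  finally show ?thesis .
qed

text \<open>
  Let \<open>\<phi>(t)\<close> be the functional applied to \<open>x \<mapsto> p(u + t (x - u))\<close>, with \<open>u\<close> the
  vector of first moments. Then \<open>\<phi>(0) = p(u)\<close>, \<open>\<phi>(1)\<close> is the functional applied to \<open>p\<close>,
  and \<open>\<phi>'(0) = 0\<close> because \<open>x - u\<close> has mean zero. The second derivative is the functional
  applied to \<open>(x - u)\<^sup>T \<nabla>\<^sup>2p(u + t (x - u)) (x - u)\<close>, which SOS-convexity writes as a sum of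
  squares in \<open>x\<close>; each square is dominated by the sum, hence has admissible degree. So \<open>\<phi>\<close> is
  convex on the half-line with a minimum at \<open>0\<close>.
\<close>

lemma sos_convex_jensen:
  assumes sos: "sos_convex p" and keys: "Poly_Mapping.keys p \<subseteq> mindices w"
  shows "poly_at p center \<le> (\<Sum>\<alpha>\<in>mindices w. Poly_Mapping.lookup p \<alpha> * y \<alpha>)"
proof -
  obtain n :: nat and P :: "nat \<Rightarrow> 'd \<Rightarrow> nat ^ 'd \<Rightarrow>\<^sub>0 real" where
    P: "\<And>x. hessian (poly_at p) x = (\<chi> i j. \<Sum>k<n. poly_at (P k i) x * poly_at (P k j) x)"
    using sos unfolding sos_convex_def by blast
  define L where "L t x = center + t *\<^sub>R (x - center)" for t x
  define \<phi> where "\<phi> t = (\<Sum>x\<in>X. c x * poly_at p (L t x))" for t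
  define \<phi>' where "\<phi>' t = (\<Sum>x\<in>X. c x *
    (\<Sum>i\<in>UNIV. (x - center) $ i * partial_deriv i (poly_at p) (L t x)))" for t
  define H where "H t x = (\<Sum>i\<in>UNIV. \<Sum>j\<in>UNIV.
    (x - center) $ i * (x - center) $ j * hessian (poly_at p) (L t x) $ i $ j)" for t x
  define q where "q t k x = (\<Sum>i\<in>UNIV. (x - center) $ i * poly_at (P k i) (L t x))" for t k x
  note rp = real_polynomial_function_poly_at
  have \<phi>_deriv: "(\<phi> has_real_derivative \<phi>' t) (at t)" for t
    unfolding \<phi>_def[abs_def] \<phi>'_def L_def
    by (intro DERIV_sum DERIV_cmult DERIV_along_line rp)
  have \<phi>'_deriv: "(\<phi>' has_real_derivative (\<Sum>x\<in>X. c x * H t x)) (at t)" for t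
    unfolding \<phi>'_def[abs_def] H_def L_def
    by (intro DERIV_sum DERIV_cmult DERIV2_along_line rp)
  have H_eq: "H t x = (\<Sum>k<n. (q t k x)\<^sup>2)" for t x
  proof -
    have "H t x = (\<Sum>i\<in>UNIV. \<Sum>j\<in>UNIV. \<Sum>k<n.
        ((x - center) $ i * poly_at (P k i) (L t x)) * ((x - center) $ j * poly_at (P k j) (L t x)))"
      unfolding H_def P by (simp add: sum_distrib_left ac_simps)
    also have "\<dots> = (\<Sum>i\<in>UNIV. \<Sum>k<n. \<Sum>j\<in>UNIV.
        ((x - center) $ i * poly_at (P k i) (L t x)) * ((x - center) $ j * poly_at (P k j) (L t x)))"
      by (intro sum.cong refl sum.swap)
    also have "\<dots> = (\<Sum>k<n. \<Sum>i\<in>UNIV. \<Sum>j\<in>UNIV.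
        ((x - center) $ i * poly_at (P k i) (L t x)) * ((x - center) $ j * poly_at (P k j) (L t x)))"
      by (rule sum.swap)
    finally show ?thesis
      by (simp add: q_def power2_eq_square sum_product)
  qed
  have H_nonneg: "0 \<le> (\<Sum>x\<in>X. c x * H t x)" for t
  proof -
    obtain C where C: "\<And>x. \<bar>H t x\<bar> \<le> C * (1 + norm x) ^ w"
      using second_line_derivative_growth[OF keys, of center t] unfolding H_def L_def by blast
    have square: "0 \<le> (\<Sum>x\<in>X. c x * (q t k x)\<^sup>2)" if "k < n" for k
    proof (rule quadrature_square_nonneg)
      show "real_polynomial_function (q t k)"
        unfolding q_def[abs_def] L_def vector_minus_component
        by (intro real_polynomial_function_sum real_polynomial_function.intros(2,4)
            real_polynomial_function_diff real_polynomial_function_component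
            real_polynomial_function_on_line rp) auto
      fix x
      have "(q t k x)\<^sup>2 \<le> H t x"
        unfolding H_eq using that by (intro member_le_sum) auto
      then show "(q t k x)\<^sup>2 \<le> C * (1 + norm x) ^ w"
        using C[of x] by linarith
    qed
    have "0 \<le> (\<Sum>k<n. \<Sum>x\<in>X. c x * (q t k x)\<^sup>2)"
      by (rule sum_nonneg) (simp only: lessThan_iff square)
    also have "\<dots> = (\<Sum>x\<in>X. c x * H t x)"
      unfolding H_eq sum_distrib_left by (rule sum.swap)
    finally show ?thesis .
  qed
  have "\<phi>' 0 = (\<Sum>i\<in>UNIV. partial_deriv i (poly_at p) center * (\<Sum>x\<in>X. c x * (x - center) $ i))"
    unfolding \<phi>'_def L_def sum_distrib_left
    by (subst sum.swap) (simp add: ac_simps)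
  then have "\<phi>' 0 = 0"
    by (simp only: centered) simp
  moreover have "\<phi>' 0 \<le> \<phi>' t" if "0 \<le> t" for t
    by (rule DERIV_nonneg_imp_nondecreasing[OF that]) (rule exI conjI \<phi>'_deriv H_nonneg)+
  ultimately have \<phi>'_nonneg: "0 \<le> \<phi>' t" if "0 \<le> t" for t
    using that by simp
  have "\<phi> 0 \<le> \<phi> 1"
    by (rule DERIV_nonneg_imp_nondecreasing[OF zero_le_one]) (rule exI conjI \<phi>_deriv \<phi>'_nonneg | assumption)+
  moreover have "\<phi> 0 = poly_at p center"
    unfolding \<phi>_def L_def by (simp add: weights_sum sum_distrib_right[symmetric])
  moreover have "\<phi> 1 = (\<Sum>\<alpha>\<in>mindices w. Poly_Mapping.lookup p \<alpha> * y \<alpha>)"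
    using quadrature_poly_at[OF keys] by (simp add: \<phi>_def L_def)
  ultimately show ?thesis
    by simp
qed

text \<open>
  The squared distance splits about the center into squares of coordinates, a linear term of mean
  zero, and the constant \<open>\<parallel>u - v\<parallel>\<^sup>2\<close>.
\<close>

lemma sq_dist_jensen:
  assumes h: "\<And>x. poly_at h x = (norm (x - v))\<^sup>2" and keys: "Poly_Mapping.keys h \<subseteq> mindices w"
  shows "(norm (center - v))\<^sup>2 \<le> (\<Sum>\<alpha>\<in>mindices w. Poly_Mapping.lookup h \<alpha> * y \<alpha>)"
proof -
  have sq: "0 \<le> (\<Sum>x\<in>X. c x * ((x - center) $ i)\<^sup>2)" for i
  proof (rule quadrature_square_nonneg)
    show "real_polynomial_function (\<lambda>x. (x - center) $ i)"
      unfolding vector_minus_component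
      by (intro real_polynomial_function_diff real_polynomial_function_component
          real_polynomial_function.intros(2))
    fix x
    have "\<bar>(x - center) $ i\<bar> \<le> norm (x - center)"
      by (rule component_le_norm_cart)
    also have "\<dots> \<le> norm x + norm center"
      by (rule norm_triangle_ineq4)
    also have "\<dots> \<le> (1 + norm center) * (1 + norm x)"
      by (simp add: algebra_simps)
    finally have "\<bar>(x - center) $ i\<bar>\<^sup>2 \<le> ((1 + norm center) * (1 + norm x))\<^sup>2"
      by (intro power_mono) auto
    also have "\<dots> \<le> (1 + norm center)\<^sup>2 * (1 + norm x) ^ w"
      using w_ge_2 unfolding power_mult_distrib by (intro mult_left_mono power_increasing) auto
    finally show "((x - center) $ i)\<^sup>2 \<le> (1 + norm center)\<^sup>2 * (1 + norm x) ^ w"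
      by simp
  qed
  have split: "(norm (x - v))\<^sup>2 = (\<Sum>i\<in>UNIV. ((x - center) $ i)\<^sup>2)
      + 2 * (\<Sum>i\<in>UNIV. (center - v) $ i * (x - center) $ i) + (norm (center - v))\<^sup>2" for x
  proof -
    have "(norm (a + b))\<^sup>2 = (norm a)\<^sup>2 + 2 * (b \<bullet> a) + (norm b)\<^sup>2" for a b :: "real ^ 'd"
      by (simp add: power2_norm_eq_inner inner_add_left inner_add_right inner_commute)
    from this[of "x - center" "center - v"]
    have "(norm (x - v))\<^sup>2
        = (norm (x - center))\<^sup>2 + 2 * ((center - v) \<bullet> (x - center)) + (norm (center - v))\<^sup>2"
      by simp
    also have "(norm (x - center))\<^sup>2 = (\<Sum>i\<in>UNIV. ((x - center) $ i)\<^sup>2)"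
      unfolding power2_norm_eq_inner inner_vec_def by (simp add: power2_eq_square)
    finally show ?thesis
      by (simp add: inner_vec_def)
  qed
  have "c x * poly_at h x = (\<Sum>i\<in>UNIV. c x * ((x - center) $ i)\<^sup>2)
      + (\<Sum>i\<in>UNIV. 2 * (center - v) $ i * (c x * (x - center) $ i))
      + c x * (norm (center - v))\<^sup>2" for x
    unfolding h split[of x] distrib_left sum_distrib_left
    by (intro arg_cong2[where f = "(+)"] sum.cong refl) (simp only: mult_ac)
  then have "(\<Sum>x\<in>X. c x * poly_at h x)
      = (\<Sum>x\<in>X. \<Sum>i\<in>UNIV. c x * ((x - center) $ i)\<^sup>2)
      + (\<Sum>x\<in>X. \<Sum>i\<in>UNIV. 2 * (center - v) $ i * (c x * (x - center) $ i))
      + (\<Sum>x\<in>X. c x) * (norm (center - v))\<^sup>2"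
    by (simp only: sum.distrib sum_distrib_right)
  also have "(\<Sum>x\<in>X. \<Sum>i\<in>UNIV. 2 * (center - v) $ i * (c x * (x - center) $ i))
      = (\<Sum>i\<in>UNIV. 2 * (center - v) $ i * (\<Sum>x\<in>X. c x * (x - center) $ i))"
    unfolding sum_distrib_left by (rule sum.swap)
  also have "\<dots> = 0"
    by (simp only: centered) simp
  also have "(\<Sum>x\<in>X. \<Sum>i\<in>UNIV. c x * ((x - center) $ i)\<^sup>2)
      = (\<Sum>i\<in>UNIV. \<Sum>x\<in>X. c x * ((x - center) $ i)\<^sup>2)"
    by (rule sum.swap)
  finally have "(\<Sum>\<alpha>\<in>mindices w. Poly_Mapping.lookup h \<alpha> * y \<alpha>)
      = (\<Sum>i\<in>UNIV. \<Sum>x\<in>X. c x * ((x - center) $ i)\<^sup>2) + (norm (center - v))\<^sup>2"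
    unfolding weights_sum quadrature_poly_at[OF keys] by simp
  moreover have "0 \<le> (\<Sum>i\<in>UNIV. \<Sum>x\<in>X. c x * ((x - center) $ i)\<^sup>2)"
    by (rule sum_nonneg) (rule sq)
  ultimately show ?thesis
    by linarith
qed

end

lemma moment_quadrature_exists:
  assumes "even w" "2 \<le> w" "y 0 = 1" "psd_moments w y"
  obtains X c where "moment_quadrature w y X c"
proof -
  obtain X :: "(real ^ 'a) set" and c where
    "finite X" "\<And>\<alpha>. \<alpha> \<in> mindices w \<Longrightarrow> (\<Sum>x\<in>X. c x * monom_at \<alpha> x) = y \<alpha>"
    using signed_quadrature_exists[of w y] by blast
  with assms show ?thesis
    by (intro that[of X c]) unfold_locales
qed

section \<open>Feasible moment vectors and the projection\<close>

lemma sdp_order_properties: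
  fixes g :: "'s::finite \<Rightarrow> (nat ^ 'd \<Rightarrow>\<^sub>0 real)"
  shows "even (sdp_order g)" "2 \<le> sdp_order g" "poly_deg (g j) \<le> sdp_order g"
proof -
  define M where "M = (MAX j. poly_deg (g j))"
  have "\<exists>w. even w \<and> M \<le> w \<and> 2 \<le> w"
    by (rule exI[of _ "2 * (M + 1)"]) auto
  then have *: "even (sdp_order g) \<and> M \<le> sdp_order g \<and> 2 \<le> sdp_order g"
    unfolding sdp_order_def M_def by (rule LeastI_ex)
  then show "even (sdp_order g)" "2 \<le> sdp_order g"
    by auto
  have "poly_deg (g j) \<le> M"
    unfolding M_def by (intro Max_ge) auto
  then show "poly_deg (g j) \<le> sdp_order g"
    using * by simp
qed

lemma keys_subset_mindices_sdp_order: "Poly_Mapping.keys (g j) \<subseteq> mindices (sdp_order g)"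
  by (intro keys_subset_mindices sdp_order_properties)

lemma mp_feasible_iff:
  "mp_feasible g y \<longleftrightarrow>
     (\<forall>j. (\<Sum>\<alpha>\<in>mindices (sdp_order g). Poly_Mapping.lookup (g j) \<alpha> * y \<alpha>) \<le> 0) \<and>
     psd_moments (sdp_order g) y \<and> y 0 = 1"
  by (simp add: mp_feasible_def psd_moments_def)

lemma mean_of_mp_feasible:
  fixes g :: "'s::finite \<Rightarrow> (nat ^ 'd \<Rightarrow>\<^sub>0 real)"
  assumes "\<And>j. sos_convex (g j)" and y: "mp_feasible g y"
  shows "poly_at (g j) (\<chi> i. y (axis i 1)) \<le> 0"
proof -
  obtain X c where "moment_quadrature (sdp_order g) y X c"
    using moment_quadrature_exists[of "sdp_order g" y] sdp_order_properties y
    unfolding mp_feasible_iff by metis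
  then interpret moment_quadrature "sdp_order g" y X c .
  have "poly_at (g j) center \<le> 0"
    using sos_convex_jensen[OF assms(1) keys_subset_mindices_sdp_order, of j] y
    unfolding mp_feasible_iff by (meson order_trans)
  then show ?thesis
    by (simp add: center_def)
qed

text \<open>
  The moments of a point mass at \<open>x\<close>: the moment matrix is the rank-one matrix
  \<open>y(x) y(x)\<^sup>T\<close>. This is why the moment problem is a relaxation of the projection problem.
\<close>

lemma mp_feasible_dirac:
  fixes g :: "'s::finite \<Rightarrow> (nat ^ 'd \<Rightarrow>\<^sub>0 real)"
  assumes "\<And>j. poly_at (g j) x \<le> 0"
  shows "mp_feasible g (\<lambda>\<alpha>. monom_at \<alpha> x)"
proof -
  have "psd_moments (sdp_order g) (\<lambda>\<alpha>. monom_at \<alpha> x)"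
    unfolding psd_moments_iff[OF sdp_order_properties(1)]
  proof
    fix a :: "nat ^ 'd \<Rightarrow> real"
    let ?I = "mindices (sdp_order g div 2)"
    have "(\<Sum>\<beta>\<in>?I. \<Sum>\<gamma>\<in>?I. a \<beta> * monom_at (\<beta> + \<gamma>) x * a \<gamma>)
        = (\<Sum>\<beta>\<in>?I. a \<beta> * monom_at \<beta> x)\<^sup>2"
      by (simp add: power2_eq_square sum_product monom_at_add ac_simps)
    then show "0 \<le> (\<Sum>\<beta>\<in>?I. \<Sum>\<gamma>\<in>?I. a \<beta> * monom_at (\<beta> + \<gamma>) x * a \<gamma>)"
      by simp
  qed
  then show ?thesis
    using assms by (simp add: mp_feasible_iff flip: poly_at_eq_sum_mindices[OF keys_subset_mindices_sdp_order])
qed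

lemma mp_feasible_convex_combination:
  fixes g :: "'s::finite \<Rightarrow> (nat ^ 'd \<Rightarrow>\<^sub>0 real)"
  assumes y: "mp_feasible g y" and z: "mp_feasible g z"
    and st: "0 \<le> s" "0 \<le> t" "s + t = 1"
  shows "mp_feasible g (\<lambda>\<alpha>. s * y \<alpha> + t * z \<alpha>)"
  unfolding mp_feasible_iff psd_moments_iff[OF sdp_order_properties(1)]
proof (intro conjI allI)
  fix j
  have "(\<Sum>\<alpha>\<in>mindices (sdp_order g). Poly_Mapping.lookup (g j) \<alpha> * (s * y \<alpha> + t * z \<alpha>))
      = s * (\<Sum>\<alpha>\<in>mindices (sdp_order g). Poly_Mapping.lookup (g j) \<alpha> * y \<alpha>)
        + t * (\<Sum>\<alpha>\<in>mindices (sdp_order g). Poly_Mapping.lookup (g j) \<alpha> * z \<alpha>)"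
    by (simp add: distrib_left sum.distrib sum_distrib_left ac_simps)
  also have "\<dots> \<le> 0"
    using y z st unfolding mp_feasible_iff by (intro add_nonpos_nonpos mult_nonneg_nonpos) auto
  finally show "(\<Sum>\<alpha>\<in>mindices (sdp_order g).
      Poly_Mapping.lookup (g j) \<alpha> * (s * y \<alpha> + t * z \<alpha>)) \<le> 0" .
next
  fix a :: "nat ^ 'd \<Rightarrow> real"
  let ?I = "mindices (sdp_order g div 2)"
  let ?Q = "\<lambda>y :: nat ^ 'd \<Rightarrow> real. \<Sum>\<beta>\<in>?I. \<Sum>\<gamma>\<in>?I. a \<beta> * y (\<beta> + \<gamma>) * a \<gamma>"
  have "?Q (\<lambda>\<alpha>. s * y \<alpha> + t * z \<alpha>) = s * ?Q y + t * ?Q z"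
    by (simp add: distrib_left distrib_right sum.distrib sum_distrib_left ac_simps)
  moreover have "0 \<le> ?Q y" "0 \<le> ?Q z"
    using y z unfolding mp_feasible_iff psd_moments_iff[OF sdp_order_properties(1)] by blast+
  ultimately show "0 \<le> ?Q (\<lambda>\<alpha>. s * y \<alpha> + t * z \<alpha>)"
    using st by simp
next
  show "s * y 0 + t * z 0 = 1"
    using y z st by (simp add: mp_feasible_iff)
qed

text \<open>
  A mixture of two point masses is a feasible moment vector, and its mean is the corresponding convex
  combination. Jensen's inequality puts this mean into the set, so the calculus relating Hessians to
  convexity does not have to be developed separately.
\<close>

lemma convex_sos_convex_sublevel:
  fixes g :: "'s::finite \<Rightarrow> (nat ^ 'd \<Rightarrow>\<^sub>0 real)"
  assumes "\<And>j. sos_convex (g j)"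
  shows "convex {x. \<forall>j. poly_at (g j) x \<le> 0}"
proof (rule convexI)
  fix x z :: "real ^ 'd" and s t :: real
  assume x: "x \<in> {x. \<forall>j. poly_at (g j) x \<le> 0}" and z: "z \<in> {x. \<forall>j. poly_at (g j) x \<le> 0}"
    and st: "0 \<le> s" "0 \<le> t" "s + t = 1"
  have "mp_feasible g (\<lambda>\<alpha>. s * monom_at \<alpha> x + t * monom_at \<alpha> z)"
    using x z st by (intro mp_feasible_convex_combination mp_feasible_dirac) auto
  from mean_of_mp_feasible[OF assms this]
  have "poly_at (g j) (\<chi> i. s * x $ i + t * z $ i) \<le> 0" for j
    unfolding monom_at_axis .
  moreover have "(\<chi> i. s * x $ i + t * z $ i) = s *\<^sub>R x + t *\<^sub>R z"
    by (simp add: vec_eq_iff)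
  ultimately show "s *\<^sub>R x + t *\<^sub>R z \<in> {x. \<forall>j. poly_at (g j) x \<le> 0}"
    by simp
qed

lemma closed_poly_sublevel: "closed {x. \<forall>j. poly_at (g j) x \<le> 0}"
proof -
  have "continuous_on UNIV (poly_at (g j))" for j
    using differentiable_at_real_polynomial_function[OF real_polynomial_function_poly_at]
      differentiable_imp_continuous_within
    by (metis continuous_at_imp_continuous_on)
  then have "closed {x. poly_at (g j) x \<le> 0}" for j
    by (intro closed_Collect_le) auto
  then show ?thesis
    by (rule closed_Collect_all)
qed

text \<open>
  The assumption describes \<open>h\<close> only as a function. The Cauchy estimate turns its quadratic growth
  into a bound on the multi-indices that occur, so that truncating \<open>h\<close> at the order of the
  relaxation loses nothing.
\<close>

lemma keys_sq_dist:
  fixes h :: "nat ^ 'd \<Rightarrow>\<^sub>0 real"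
  assumes h: "\<And>x. poly_at h x = (norm (x - v))\<^sup>2"
  shows "Poly_Mapping.keys h \<subseteq> mindices 2"
proof
  fix \<alpha>
  assume \<alpha>: "\<alpha> \<in> Poly_Mapping.keys h"
  have keys: "Poly_Mapping.keys h \<subseteq> mindices (poly_deg h)"
    by (intro keys_subset_mindices order_refl)
  have "\<bar>poly_at h x\<bar> \<le> (1 + norm v)\<^sup>2 * (1 + norm x) ^ 2" for x
  proof -
    have "norm (x - v) \<le> norm x + norm v"
      by (rule norm_triangle_ineq4)
    also have "\<dots> \<le> (1 + norm v) * (1 + norm x)"
      by (simp add: algebra_simps)
    finally have "(norm (x - v))\<^sup>2 \<le> ((1 + norm v) * (1 + norm x))\<^sup>2"
      by (intro power_mono) auto
    then show ?thesis
      by (simp add: h power_mult_distrib)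
  qed
  then have "Poly_Mapping.lookup h \<alpha> = 0" if "2 < mindex_deg \<alpha>"
    using coefficient_eq_0_of_growth[OF poly_at_eq_sum_mindices[OF keys]] \<alpha> keys that by blast
  then show "\<alpha> \<in> mindices 2"
    using \<alpha> by (force simp: mindices_def in_keys_iff)
qed

theorem theorem4p2:
  fixes v :: "real ^ 'd"
    and h :: "nat ^ 'd \<Rightarrow>\<^sub>0 real"
    and g :: "'s::finite \<Rightarrow> (nat ^ 'd \<Rightarrow>\<^sub>0 real)"
    and D :: "(real ^ 'd) set"
    and y :: "nat ^ 'd \<Rightarrow> real"
  assumes "\<And>x. poly_at h x = (norm (x - v))\<^sup>2"
    and "\<And>j. sos_convex (g j)"
    and "D = {x. \<forall>j. poly_at (g j) x \<le> 0}"
    and "max_sdp_eq_min_mp h g"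
    and "is_arg_min (mp_objective h g) (mp_feasible g) y"
  shows "closest_point D v = (\<chi> i. y (axis i 1))"
proof -
  note h = assms(1) and sos = assms(2) and D = assms(3)
  have feas: "mp_feasible g y" and min: "\<And>z. mp_feasible g z \<Longrightarrow> mp_objective h g y \<le> mp_objective h g z"
    using assms(5) by (auto simp: is_arg_min_linorder)
  let ?u = "\<chi> i. y (axis i 1)"
  have keys: "Poly_Mapping.keys h \<subseteq> mindices (sdp_order g)"
    using keys_sq_dist[OF h] sdp_order_properties(2)[of g] by (auto simp: mindices_def)
  obtain X c where "moment_quadrature (sdp_order g) y X c"
    using moment_quadrature_exists[of "sdp_order g" y] sdp_order_properties feas
    unfolding mp_feasible_iff by metis
  then interpret moment_quadrature "sdp_order g" y X c .
  have u_le: "(norm (?u - v))\<^sup>2 \<le> mp_objective h g y"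
    using sq_dist_jensen[OF h keys] by (simp add: mp_objective_def center_def)
  have "?u = closest_point D v"
  proof (rule closest_point_unique)
    show "convex D" "closed D"
      unfolding D using convex_sos_convex_sublevel[OF sos] closed_poly_sublevel by auto
    show "?u \<in> D"
      unfolding D using mean_of_mp_feasible[OF sos feas] by blast
    show "\<forall>z\<in>D. dist v ?u \<le> dist v z"
    proof
      fix z
      assume "z \<in> D"
      then have "mp_feasible g (\<lambda>\<alpha>. monom_at \<alpha> z)"
        unfolding D by (intro mp_feasible_dirac) auto
      then have "mp_objective h g y \<le> mp_objective h g (\<lambda>\<alpha>. monom_at \<alpha> z)"
        by (rule min)
      also have "\<dots> = (norm (z - v))\<^sup>2"
        unfolding mp_objective_def by (simp add: h flip: poly_at_eq_sum_mindices[OF keys])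
      finally have "(norm (?u - v))\<^sup>2 \<le> (norm (z - v))\<^sup>2"
        using u_le by linarith
      then show "dist v ?u \<le> dist v z"
        by (simp add: dist_norm norm_minus_commute)
    qed
  qed
  then show ?thesis
    by simp
qed

end
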